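(* Let $F$ be the global loss, $\{\mathcal{S}_t\}$ the given collection of scheduling sets and $(\bm{w}_t)$ the federated learning iterates described in the context. Suppose that (i) ($L$-smoothness) the differentiable function $F$ is smooth with a positive constant $L$, i.e., for all $\bm{v}$ and $\bm{w}$ in $\mathbb{R}^d$, $$F(\bm{v}) \leq F(\bm{w}) + (\bm{v}-\bm{w})^{\mathsf T}\nabla F(\bm{w}) + \frac{L}{2}\|\bm{v}-\bm{w}\|_2^2;$$ (ii) (bounded local gradients) the local gradients at all devices are uniformly bounded, i.e., there exists a constant $\kappa\ge 0$ such that $\|\nabla f(\bm{w};\bm{\xi})\|_2^2\leq \kappa$ for all $\bm{w}$ and all $\bm{\xi}$. Then, given the collection of scheduling results $\{\mathcal{S}_t\}$ and setting the learning rate to be $0<\eta_t\equiv\varsigma\leq \frac1L$, the average squared norm of the global gradients after $\tau$ rounds is upper bounded by $$\frac{1}{\tau}\sum_{t=1}^{\tau}\|\nabla F(\bm{w}_{t-1})\|_2^2 \;\leq\; \frac{2\left(F(\bm{w}_0)-F(\bm{w}^* )\right)}{\varsigma\,\tau} + \frac{4\kappa}{\tau}\sum_{t=1}^{\tau}\left(1-\sum_{k\in\mathcal{S}_t}\alpha_k\right)^2,$$ where $\bm{w}^*$ is the globally optimal solution of the problem of minimizing $F(\bm{w})$ over $\bm{w}\in\mathbb{R}^d$.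
   Context: Setting. There are $K$ devices indexed by $\mathcal{K}=\{1,\dots,K\}$ and one edge server. Each device $k$ has its own local dataset of $n_k$ data samples $\bm{\xi}_{k,1},\dots,\bm{\xi}_{k,n_k}$. The weights satisfy $\alpha_k>0$ for all $k\in\mathcal{K}$ and $\sum_{k\in\mathcal{K}}\alpha_k=1$. For a data sample $\bm{\xi}$, $f(\cdot;\bm{\xi})$ is the local loss function on $\mathbb{R}^d$, and $\nabla f(\bm{w};\bm{\xi})$ is its gradient with respect to the model parameters $\bm{w}\in\mathbb{R}^d$. Global loss. $F(\bm{w})=\sum_{k\in\mathcal{K}}\alpha_k\,\mathbb{E}_{\bm{\xi}\sim\mathcal{D}_k}[f(\bm{w};\bm{\xi})]$, where for device $k$ the data sample $\bm{\xi}$ obeys a certain probability distribution $\mathcal{D}_k$. Federated learning process. Let $\tau$ be the number of rounds and $\bm{w}_0\in\mathbb{R}^d$ the initial global model. In each round $t$ a nonempty set $\mathcal{S}_t\subseteq\mathcal{K}$ of devices is scheduled (a round with no scheduled device is postponed). Each scheduled device $k\in\mathcal{S}_t$ receives the current global model $\bm{w}_{t-1}$ and performs one gradient descent step on its local dataset with learning rate $\eta_t$, $$\bm{w}_{k,t}=\bm{w}_{t-1}-\eta_t\,\frac{\sum_{i=1}^{n_k}\nabla f(\bm{w}_{t-1};\bm{\xi}_{k,i})}{n_k}.$$ The local models are transmitted without error, and the server aggregates them into the new global model $$\bm{w}_t=\frac{\sum_{k\in\mathcal{S}_t}\alpha_k\bm{w}_{k,t}}{\sum_{k\in\mathcal{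S}_t}\alpha_k}.$$
   Formalization: Adds the assumption that at each visited global model w_{t-1}, every device's average gradient over its local dataset equals the expected gradient under D_k (true if D_k is the empirical distribution of the dataset); without such a link the stated bound is false. *)

theory Defs
  imports "HOL-Probability.Probability"
begin

text \<open>The gradient of a scalar function; meaningful wherever \<open>g\<close> is differentiable.\<close>

definition gradient :: "('a::real_inner \<Rightarrow> real) \<Rightarrow> 'a \<Rightarrow> 'a" where
  "gradient g w = (THE D. GDERIV g w :> D)"

definition global_loss ::
  "nat \<Rightarrow> (nat \<Rightarrow> real) \<Rightarrow> (nat \<Rightarrow> 'x measure) \<Rightarrow> ('a \<Rightarrow> 'x \<Rightarrow> real) \<Rightarrow> 'a \<Rightarrow> real" where
  "global_loss K \<alpha> D f w = (\<Sum>k\<in>{1..K}. \<alpha> k * (LINT x|D k. f w x))"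

definition local_gradient ::
  "('a::real_inner \<Rightarrow> 'x \<Rightarrow> real) \<Rightarrow> nat \<Rightarrow> (nat \<Rightarrow> 'x) \<Rightarrow> 'a \<Rightarrow> 'a" where
  "local_gradient f m X w = (\<Sum>i\<in>{1..m}. gradient (\<lambda>v. f v (X i)) w) /\<^sub>R real m"

definition local_update ::
  "('a::real_inner \<Rightarrow> 'x \<Rightarrow> real) \<Rightarrow> nat \<Rightarrow> (nat \<Rightarrow> 'x) \<Rightarrow> real \<Rightarrow> 'a \<Rightarrow> 'a" where
  "local_update f m X \<eta> w = w - \<eta> *\<^sub>R local_gradient f m X w"

text \<open>
  Rounds are numbered from 1: round \<open>Suc t\<close> uses the scheduling set \<open>S (Suc t)\<close> and the
  learning rate \<open>\<eta> (Suc t)\<close> and turns the \<open>t\<close>-th global model into the \<open>Suc t\<close>-th.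
  The samples of device \<open>k\<close> are \<open>\<xi> k 1, \<dots>, \<xi> k (n k)\<close>.
\<close>

primrec fl_model ::
  "('a::real_inner \<Rightarrow> 'x \<Rightarrow> real) \<Rightarrow> (nat \<Rightarrow> real) \<Rightarrow> (nat \<Rightarrow> nat) \<Rightarrow> (nat \<Rightarrow> nat \<Rightarrow> 'x) \<Rightarrow>
    (nat \<Rightarrow> nat set) \<Rightarrow> (nat \<Rightarrow> real) \<Rightarrow> 'a \<Rightarrow> nat \<Rightarrow> 'a" where
  "fl_model f \<alpha> n \<xi> S \<eta> w0 0 = w0"
| "fl_model f \<alpha> n \<xi> S \<eta> w0 (Suc t) =
     (\<Sum>k\<in>S (Suc t). \<alpha> k *\<^sub>R local_update f (n k) (\<xi> k) (\<eta> (Suc t)) (fl_model f \<alpha> n \<xi> S \<eta> w0 t))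
       /\<^sub>R (\<Sum>k\<in>S (Suc t). \<alpha> k)"

text \<open>
  The local dataset \<open>X 1, \<dots>, X m\<close> represents the distribution \<open>P\<close> at \<open>w\<close>: the
  average gradient over the dataset is the expected gradient under \<open>P\<close>. Gradient descent
  on the datasets is gradient descent on the (expected) global loss only under such a condition;
  it always holds if \<open>P\<close> is the empirical distribution of the dataset
  (\<open>representative_empirical\<close> below).
\<close>

definition representative ::
  "'x measure \<Rightarrow> ('a::euclidean_space \<Rightarrow> 'x \<Rightarrow> real) \<Rightarrow> nat \<Rightarrow> (nat \<Rightarrow> 'x) \<Rightarrow> 'a \<Rightarrow> bool" where
  "representative P f m X w \<longleftrightarrow> (LINT x|P. gradient (\<lambda>v. f v x) w) = local_gradient f m X w"

lemma representative_empirical: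
  fixes f :: "'a::euclidean_space \<Rightarrow> 'x \<Rightarrow> real"
  assumes "m > 0"
  shows "representative (measure_pmf (map_pmf X (pmf_of_set {1..m}))) f m X w"
proof -
  have "(LINT i|measure_pmf (pmf_of_set {1..m}). gradient (\<lambda>v. f v (X i)) w)
          = (\<Sum>i\<in>{1..m}. pmf (pmf_of_set {1..m}) i *\<^sub>R gradient (\<lambda>v. f v (X i)) w)"
    using assms by (intro integral_measure_pmf) auto
  also have "\<dots> = local_gradient f m X w"
    using assms by (simp add: local_gradient_def scaleR_sum_right divide_inverse)
  finally show ?thesis
    by (simp add: representative_def)
qed

end

theory Submission
  imports Defs
begin

text \<open>
  Differentiating under the integral sign, \<open>\<nabla>F(w)\<close> at an iterate is the weighted sum
  \<open>g = \<Sum>\<^sub>k \<alpha>\<^sub>k g\<^sub>k\<close> of the local gradients over all devices, while a round moves along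
  \<open>-\<eta> p\<close>, where \<open>p\<close> is their weighted mean over the scheduled devices only. With
  \<open>A = \<Sum>\<^bsub>k\<in>S\<^esub> \<alpha>\<^sub>k\<close>, the unscheduled devices and the renormalisation each contribute at most
  \<open>(1 - A) \<surd>\<kappa>\<close> to \<open>\<parallel>g - p\<parallel>\<close>. As \<open>\<eta> L \<le> 1\<close>, smoothness makes every round decrease \<open>F\<close>
  by at least \<open>\<eta>/2 (\<parallel>g\<parallel>\<^sup>2 - \<parallel>g - p\<parallel>\<^sup>2)\<close>, and the sum over the rounds telescopes.
\<close>

section \<open>Gradients of scalar functions\<close>

lemma gradient_eqI:
  fixes g :: "'a::real_inner \<Rightarrow> real"
  assumes "GDERIV g w :> D"
  shows "gradient g w = D"
  unfolding gradient_def
proof (rule the_equality)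
  show "GDERIV g w :> D" by fact
next
  fix D' assume "GDERIV g w :> D'"
  then have "(\<lambda>h. h \<bullet> D') = (\<lambda>h. h \<bullet> D)"
    using assms has_derivative_unique unfolding gderiv_def by blast
  then show "D' = D"
    by (metis vector_eq_ldot)
qed

text \<open>This is Riesz representation in coordinates: by linearity the derivative is the inner
  product with the vector whose coordinates are its values on \<open>Basis\<close>. So the definite
  description in \<open>gradient\<close> denotes a genuine object at every point of
  differentiability.\<close>

lemma GDERIV_gradient:
  fixes g :: "'a::euclidean_space \<Rightarrow> real"
  assumes "g differentiable (at w)"
  shows "GDERIV g w :> gradient g w"
proof -
  obtain g' where g': "(g has_derivative g') (at w)"
    using assms by (auto simp: differentiable_def)
  interpret linear g'
    using g' by (rule has_derivative_linear)
  have "g' h = h \<bullet> (\<Sum>b\<in>Basis. g' b *\<^sub>R b)" for h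
  proof -
    have "g' h = g' (\<Sum>b\<in>Basis. (h \<bullet> b) *\<^sub>R b)"
      by (simp add: euclidean_representation)
    also have "\<dots> = (\<Sum>b\<in>Basis. (h \<bullet> b) * g' b)"
      by (simp add: sum scaleR)
    finally show ?thesis
      by (simp add: inner_sum_right mult.commute)
  qed
  then have "g' = (\<lambda>h. h \<bullet> (\<Sum>b\<in>Basis. g' b *\<^sub>R b))"
    by blast
  then have "GDERIV g w :> (\<Sum>b\<in>Basis. g' b *\<^sub>R b)"
    using g' unfolding gderiv_def by argo
  then show ?thesis
    using gradient_eqI by metis
qed

lemma GDERIV_sum_mult:
  fixes g :: "'i \<Rightarrow> 'a::real_inner \<Rightarrow> real"
  assumes "\<And>i. i \<in> I \<Longrightarrow> GDERIV (g i) w :> D i"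
  shows "GDERIV (\<lambda>v. \<Sum>i\<in>I. c i * g i v) w :> (\<Sum>i\<in>I. c i *\<^sub>R D i)"
  unfolding gderiv_def
proof (rule has_derivative_eq_rhs)
  show "((\<lambda>v. \<Sum>i\<in>I. c i * g i v) has_derivative (\<lambda>h. \<Sum>i\<in>I. c i * (h \<bullet> D i))) (at w)"
    using assms unfolding gderiv_def
    by (intro has_derivative_sum has_derivative_mult_right) auto
qed (simp add: inner_sum_right)

text \<open>The mean value inequality on the whole space, where the operator norm of the derivative
  is controlled by Cauchy-Schwarz. It later dominates difference quotients uniformly in the
  sample.\<close>

lemma lipschitz_of_bounded_gradient:
  fixes g :: "'a::euclidean_space \<Rightarrow> real"
  assumes diff: "\<And>v. g differentiable (at v)"
    and bound: "\<And>v. norm (gradient g v) \<le> C"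
  shows "\<bar>g v - g w\<bar> \<le> C * norm (v - w)"
proof -
  have "onorm (\<lambda>h. h \<bullet> gradient g u) \<le> C" for u
  proof (rule onorm_le)
    fix h
    have "norm (h \<bullet> gradient g u) \<le> norm h * norm (gradient g u)"
      using Cauchy_Schwarz_ineq2 by auto
    also have "\<dots> \<le> norm h * C"
      using bound by (intro mult_left_mono) auto
    finally show "norm (h \<bullet> gradient g u) \<le> C * norm h"
      by (simp add: mult.commute)
  qed
  then show ?thesis
    using differentiable_bound[of UNIV g "\<lambda>u h. h \<bullet> gradient g u" C v w]
      GDERIV_gradient[OF diff]
    by (auto simp: gderiv_def)
qed

section \<open>Differentiation under the integral sign\<close>

text \<open>A countable sequence of difference quotients, rather than a continuous limit, is what
  transfers measurability in the sample from \<open>f\<close> to its gradient.\<close>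

lemma gradient_component_limit:
  fixes g :: "'a::euclidean_space \<Rightarrow> real"
  assumes "g differentiable (at w)"
  shows "(\<lambda>i. (g (w + (1 / real (Suc i)) *\<^sub>R b) - g w) * real (Suc i))
           \<longlonglongrightarrow> b \<bullet> gradient g w"
proof -
  have g: "(g has_derivative (\<lambda>h. h \<bullet> gradient g w)) (at (w + 0 *\<^sub>R b))"
    using GDERIV_gradient[OF assms] by (simp add: gderiv_def)
  have line: "((\<lambda>s::real. w + s *\<^sub>R b) has_derivative (\<lambda>s. s *\<^sub>R b)) (at 0)"
    by (auto intro!: derivative_eq_intros)
  have "((\<lambda>s::real. g (w + s *\<^sub>R b)) has_derivative (\<lambda>s. (s *\<^sub>R b) \<bullet> gradient g w)) (at 0)"
    using has_derivative_compose[OF line g] .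
  then have "((\<lambda>s::real. g (w + s *\<^sub>R b)) has_real_derivative b \<bullet> gradient g w) (at 0)"
    by (simp add: has_field_derivative_def mult.commute[of _ "b \<bullet> gradient g w"])
  then have lim: "((\<lambda>s. (g (w + s *\<^sub>R b) - g w) / s) \<longlongrightarrow> b \<bullet> gradient g w) (at 0)"
    using DERIV_D by fastforce
  \<comment> \<open>The numbers \<open>1 / real (Suc i)\<close> are never 0, so the sequence stays
    in the punctured neighbourhoods of \<open>at 0\<close>.\<close>
  have seq: "filterlim (\<lambda>i. 1 / real (Suc i)) (at 0) sequentially"
    using LIMSEQ_inverse_real_of_nat by (auto simp: filterlim_at divide_inverse)
  show ?thesis
    using filterlim_compose[OF lim seq] by simp
qed

lemma integrable_gradient:
  fixes f :: "'a::euclidean_space \<Rightarrow> 'x \<Rightarrow> real"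
  assumes "finite_measure P"
    and diff: "\<And>x. x \<in> space P \<Longrightarrow> (\<lambda>v. f v x) differentiable (at w)"
    and meas: "\<And>v. f v \<in> borel_measurable P"
    and bound: "\<And>x. x \<in> space P \<Longrightarrow> norm (gradient (\<lambda>v. f v x) w) \<le> C"
  shows "integrable P (\<lambda>x. gradient (\<lambda>v. f v x) w)"
proof -
  interpret finite_measure P by fact
  have "(\<lambda>x. gradient (\<lambda>v. f v x) w) \<in> borel_measurable P"
  proof (subst borel_measurable_euclidean_space, intro ballI)
    fix b :: 'a
    have "(\<lambda>x. b \<bullet> gradient (\<lambda>v. f v x) w) \<in> borel_measurable P"
    proof (rule borel_measurable_LIMSEQ_real)
      show "(\<lambda>i. (f (w + (1 / real (Suc i)) *\<^sub>R b) x - f w x) * real (Suc i))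
              \<longlonglongrightarrow> b \<bullet> gradient (\<lambda>v. f v x) w" if "x \<in> space P" for x
        using gradient_component_limit[OF diff[OF that]] .
    qed (use meas in measurable)
    then show "(\<lambda>x. gradient (\<lambda>v. f v x) w \<bullet> b) \<in> borel_measurable P"
      by (simp add: inner_commute)
  qed
  then show ?thesis
    using bound by (intro integrable_const_bound[where B = C]) auto
qed

text \<open>Dominated convergence is applied to the normalised first-order remainder
  \<open>q\<close>: it tends to 0 for each sample by differentiability, and it is at most
  \<open>2 * C\<close>, one \<open>C\<close> from the Lipschitz bound and one from the linear
  term.\<close>

lemma GDERIV_integral:
  fixes f :: "'a::euclidean_space \<Rightarrow> 'x \<Rightarrow> real"
  assumes fin: "finite_measure P"
    and diff: "\<And>v x. x \<in> space P \<Longrightarrow> (\<lambda>v. f v x) differentiable (at v)"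
    and int: "\<And>v. integrable P (f v)"
    and bound: "\<And>v x. x \<in> space P \<Longrightarrow> norm (gradient (\<lambda>v. f v x) v) \<le> C"
  shows "GDERIV (\<lambda>v. LINT x|P. f v x) w :> (LINT x|P. gradient (\<lambda>v. f v x) w)"
proof -
  interpret finite_measure P by (rule fin)
  define G where "G x = gradient (\<lambda>v. f v x) w" for x
  have G_int: "integrable P G"
    unfolding G_def using fin diff int bound by (intro integrable_gradient) auto
  define q where "q v x = (f v x - f w x - (v - w) \<bullet> G x) / norm (v - w)" for v x
  have q_int: "(LINT x|P. q v x)
      = ((LINT x|P. f v x) - (LINT x|P. f w x) - (v - w) \<bullet> (LINT x|P. G x)) / norm (v - w)" for v
    unfolding q_def using int G_int by simp
  have q_bound: "norm (q v x) \<le> 2 * C" if "x \<in> space P" for v x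
  proof (cases "v = w")
    \<comment> \<open>Division by zero yields 0, so \<open>q\<close> vanishes here and only the sign
      of \<open>C\<close> matters; it follows from the existence of the sample
      \<open>x\<close>.\<close>
    case True
    have "0 \<le> C"
      using bound[OF that] norm_ge_zero order_trans by blast
    then show ?thesis
      by (simp add: q_def True)
  next
    case False
    have "\<bar>f v x - f w x\<bar> \<le> C * norm (v - w)"
      using lipschitz_of_bounded_gradient[of "\<lambda>v. f v x"] diff bound that by auto
    moreover have "\<bar>(v - w) \<bullet> G x\<bar> \<le> norm (v - w) * norm (G x)"
      by (rule Cauchy_Schwarz_ineq2)
    moreover have "norm (v - w) * norm (G x) \<le> norm (v - w) * C"
      unfolding G_def using bound that by (intro mult_left_mono) auto
    ultimately have "\<bar>f v x - f w x - (v - w) \<bullet> G x\<bar> \<le> 2 * C * norm (v - w)"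
      by (simp add: abs_le_iff algebra_simps)
    then show ?thesis
      using False by (simp add: q_def field_simps)
  qed
  have q_lim: "((\<lambda>v. q v x) \<longlongrightarrow> 0) (at w)" if "x \<in> space P" for x
  proof -
    have "((\<lambda>v. f v x) has_derivative (\<lambda>h. h \<bullet> G x)) (at w)"
      using GDERIV_gradient[OF diff[OF that]] by (simp add: gderiv_def G_def)
    then show ?thesis
      by (simp add: has_derivative_at_within q_def divide_inverse mult.commute)
  qed
  have "((\<lambda>v. LINT x|P. q v x) \<longlongrightarrow> 0) (at w)"
    \<comment> \<open>Dominated convergence speaks of sequences, so the limit at \<open>w\<close> is
      tested along an arbitrary sequence avoiding \<open>w\<close>.\<close>
    unfolding tendsto_at_iff_sequentially
  proof (intro allI impI)
    fix X :: "nat \<Rightarrow> 'a"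
    assume X: "\<forall>i. X i \<in> UNIV - {w}" "X \<longlonglongrightarrow> w"
    have "(\<lambda>i. LINT x|P. q (X i) x) \<longlonglongrightarrow> (LINT x|P. 0)"
    proof (rule integral_dominated_convergence[where w = "\<lambda>_. 2 * C"])
      show "AE x in P. (\<lambda>i. q (X i) x) \<longlonglongrightarrow> 0"
        using q_lim X unfolding tendsto_at_iff_sequentially by (auto simp: o_def)
      show "AE x in P. norm (q (X i) x) \<le> 2 * C" for i
        using q_bound by auto
      show "q (X i) \<in> borel_measurable P" for i
        unfolding q_def using int G_int by measurable
    qed auto
    then show "((\<lambda>v. LINT x|P. q v x) \<circ> X) \<longlonglongrightarrow> 0"
      by (simp add: o_def)
  qed
  \<comment> \<open>By \<open>q_int\<close>, the integral of \<open>q\<close> is exactly the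
    normalised remainder of the integrated function.\<close>
  then have "((\<lambda>v. LINT x|P. f v x) has_derivative (\<lambda>h. h \<bullet> (LINT x|P. G x))) (at w)"
    by (simp add: has_derivative_at_within q_int divide_inverse mult.commute
        bounded_linear_inner_left)
  then show ?thesis
    by (simp add: gderiv_def G_def)
qed

section \<open>Averages of local gradients\<close>

lemma norm_local_gradient_le:
  assumes "m > 0"
    and "\<And>i. i \<in> {1..m} \<Longrightarrow> norm (gradient (\<lambda>v. f v (X i)) w) \<le> C"
  shows "norm (local_gradient f m X w) \<le> C"
proof -
  have "norm (\<Sum>i\<in>{1..m}. gradient (\<lambda>v. f v (X i)) w) \<le> (\<Sum>i\<in>{1..m}. C)"
    using assms(2) by (rule sum_norm_le)
  then show ?thesis
    using assms(1) by (simp add: local_gradient_def field_simps)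
qed

lemma norm_weighted_sum_le:
  fixes g :: "'i \<Rightarrow> 'a::real_normed_vector"
  assumes "\<And>k. k \<in> I \<Longrightarrow> 0 \<le> a k"
    and "\<And>k. k \<in> I \<Longrightarrow> norm (g k) \<le> C"
  shows "norm (\<Sum>k\<in>I. a k *\<^sub>R g k) \<le> sum a I * C"
  unfolding sum_distrib_right
  using assms by (intro sum_norm_le) (simp add: mult_left_mono)

text \<open>With \<open>A = sum a J\<close>, the terms outside \<open>J\<close> carry weight
  \<open>1 - A\<close>, and renormalising inside \<open>J\<close> changes the weights by a total of
  \<open>(inverse A - 1) * A\<close>, which is again \<open>1 - A\<close>.\<close>

lemma norm_sum_diff_partial_mean_le:
  fixes g :: "'i \<Rightarrow> 'a::real_normed_vector"
  assumes "finite I" "J \<subseteq> I" "J \<noteq> {}"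
    and pos: "\<And>k. k \<in> I \<Longrightarrow> 0 < a k"
    and total: "sum a I = 1"
    and bound: "\<And>k. k \<in> I \<Longrightarrow> norm (g k) \<le> C"
  shows "norm ((\<Sum>k\<in>I. a k *\<^sub>R g k) - (\<Sum>k\<in>J. a k *\<^sub>R g k) /\<^sub>R sum a J) \<le> 2 * (1 - sum a J) * C"
proof -
  define A where "A = sum a J"
  have "finite J"
    using assms finite_subset by blast
  then have A_pos: "0 < A"
    unfolding A_def using assms by (intro sum_pos) auto
  have rest: "sum a (I - J) = 1 - A"
    using assms sum_diff[of I J a] by (simp add: A_def)
  moreover have "0 \<le> sum a (I - J)"
    using pos by (intro sum_nonneg) (auto intro: less_imp_le)
  ultimately have A_le: "A \<le> 1"
    by simp
  let ?s = "\<Sum>k\<in>J. a k *\<^sub>R g k" and ?r = "\<Sum>k\<in>I - J. a k *\<^sub>R g k"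
  have "(\<Sum>k\<in>I. a k *\<^sub>R g k) - ?s /\<^sub>R A = ?r - (inverse A - 1) *\<^sub>R ?s"
    using assms by (simp add: sum.subset_diff[of J I] algebra_simps)
  then have "norm ((\<Sum>k\<in>I. a k *\<^sub>R g k) - ?s /\<^sub>R A) \<le> norm ?r + norm ((inverse A - 1) *\<^sub>R ?s)"
    using norm_triangle_ineq4 by metis
  also have "norm ?r \<le> (1 - A) * C"
    unfolding rest[symmetric] using pos bound
    by (intro norm_weighted_sum_le) (auto intro: less_imp_le)
  also have "norm ((inverse A - 1) *\<^sub>R ?s) \<le> (1 - A) * C"
  proof -
    have "norm ?s \<le> A * C"
      unfolding A_def using pos bound \<open>J \<subseteq> I\<close>
      by (intro norm_weighted_sum_le) (auto intro: less_imp_le)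
    moreover have "0 \<le> inverse A - 1"
      using A_pos A_le by (simp add: field_simps)
    ultimately have "norm ((inverse A - 1) *\<^sub>R ?s) \<le> (inverse A - 1) * (A * C)"
      by (simp add: mult_left_mono)
    also have "\<dots> = (1 - A) * C"
      using A_pos by (simp add: field_simps)
    finally show ?thesis .
  qed
  finally show ?thesis
    by (simp add: A_def algebra_simps)
qed

section \<open>A single round\<close>

text \<open>All scheduled devices start from the same model, and the normalised weights sum to 1, so
  averaging leaves that model fixed and only averages the gradients. A zero total weight would make
  the division degenerate.\<close>

lemma fl_model_Suc:
  fixes f :: "'a::real_inner \<Rightarrow> 'x \<Rightarrow> real" and \<alpha> n \<xi> S \<eta> w0
  defines "W \<equiv> fl_model f \<alpha> n \<xi> S \<eta> w0"
  assumes "(\<Sum>k\<in>S (Suc t). \<alpha> k) \<noteq> 0"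
  shows "W (Suc t) = W t - \<eta> (Suc t) *\<^sub>R
    ((\<Sum>k\<in>S (Suc t). \<alpha> k *\<^sub>R local_gradient f (n k) (\<xi> k) (W t)) /\<^sub>R (\<Sum>k\<in>S (Suc t). \<alpha> k))"
  using assms(2)
  by (simp add: W_def local_update_def scaleR_diff_right sum_subtractf
      scaleR_sum_left[symmetric] scaleR_sum_right mult_ac)

lemma inexact_gradient_step:
  fixes g p w :: "'a::real_inner"
  assumes smooth: "F (w - \<sigma> *\<^sub>R p)
      \<le> F w + (w - \<sigma> *\<^sub>R p - w) \<bullet> g + L / 2 * (norm (w - \<sigma> *\<^sub>R p - w))\<^sup>2"
    and "0 < \<sigma>" "\<sigma> * L \<le> 1"
  shows "\<sigma> / 2 * (norm g)\<^sup>2 \<le> F w - F (w - \<sigma> *\<^sub>R p) + \<sigma> / 2 * (norm (g - p))\<^sup>2"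
proof -
  \<comment> \<open>The step size condition lets the quadratic smoothness term be absorbed into
    \<open>\<sigma> / 2 * (norm p)\<^sup>2\<close>.\<close>
  have "L / 2 * (\<sigma> * norm p)\<^sup>2 = \<sigma> / 2 * (norm p)\<^sup>2 * (\<sigma> * L)"
    by (simp add: power2_eq_square)
  also have "\<dots> \<le> \<sigma> / 2 * (norm p)\<^sup>2 * 1"
    using assms by (intro mult_left_mono) auto
  finally have "F (w - \<sigma> *\<^sub>R p) \<le> F w - \<sigma> * (p \<bullet> g) + \<sigma> / 2 * (norm p)\<^sup>2"
    using smooth \<open>0 < \<sigma>\<close> by simp
  \<comment> \<open>Expanding the square reproduces the same cross term and the same
    \<open>p\<close> term, so both cancel exactly.\<close>
  moreover have "\<sigma> / 2 * (norm (g - p))\<^sup>2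
      = \<sigma> / 2 * (norm g)\<^sup>2 - \<sigma> * (p \<bullet> g) + \<sigma> / 2 * (norm p)\<^sup>2"
    by (simp add: dot_norm_neg norm_minus_commute field_simps)
  ultimately show ?thesis
    by linarith
qed

section \<open>Summation over the rounds\<close>

theorem theorem1:
  fixes K \<tau> :: nat
    and \<alpha> :: "nat \<Rightarrow> real"
    and M :: "'x measure"
    and D :: "nat \<Rightarrow> 'x measure"
    and f :: "real ^ 'd \<Rightarrow> 'x \<Rightarrow> real"
    and n :: "nat \<Rightarrow> nat"
    and \<xi> :: "nat \<Rightarrow> nat \<Rightarrow> 'x"
    and S :: "nat \<Rightarrow> nat set"
    and \<eta> :: "nat \<Rightarrow> real"
    and \<sigma> L \<kappa> :: real
    and w0 wopt :: "real ^ 'd"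
  defines "F \<equiv> global_loss K \<alpha> D f"
    and "W \<equiv> fl_model f \<alpha> n \<xi> S \<eta> w0"
  assumes weights_pos: "\<And>k. k \<in> {1..K} \<Longrightarrow> \<alpha> k > 0"
    and weights_sum: "(\<Sum>k\<in>{1..K}. \<alpha> k) = 1"
    and distributions: "\<And>k. k \<in> {1..K} \<Longrightarrow> prob_space (D k) \<and> sets (D k) = sets M"
    and datasets_nonempty: "\<And>k. k \<in> {1..K} \<Longrightarrow> n k > 0"
    and samples: "\<And>k i. k \<in> {1..K} \<Longrightarrow> i \<in> {1..n k} \<Longrightarrow> \<xi> k i \<in> space M"
    and loss_differentiable:
      "\<And>w x. x \<in> space M \<Longrightarrow> (\<lambda>v. f v x) differentiable (at w)"
    and loss_integrable: "\<And>k w. k \<in> {1..K} \<Longrightarrow> integrable (D k) (f w)"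
    and rounds: "\<tau> > 0"
    and scheduling: "\<And>t. t \<in> {1..\<tau>} \<Longrightarrow> S t \<noteq> {} \<and> S t \<subseteq> {1..K}"
    and datasets_representative:
      "\<And>k t. k \<in> {1..K} \<Longrightarrow> t \<in> {1..\<tau>} \<Longrightarrow> representative (D k) f (n k) (\<xi> k) (W (t - 1))"
    and L_pos: "L > 0"
    and F_differentiable: "\<And>w. F differentiable (at w)"
    and F_smooth:
      "\<And>v w. F v \<le> F w + (v - w) \<bullet> gradient F w + L / 2 * (norm (v - w))\<^sup>2"
    and \<kappa>_nonneg: "\<kappa> \<ge> 0"
    and gradients_bounded:
      "\<And>w x. x \<in> space M \<Longrightarrow> (norm (gradient (\<lambda>v. f v x) w))\<^sup>2 \<le> \<kappa>"
    and learning_rate: "\<And>t. t \<in> {1..\<tau>} \<Longrightarrow> \<eta> t = \<sigma>"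
    and learning_rate_pos: "0 < \<sigma>"
    and learning_rate_le: "\<sigma> \<le> 1 / L"
    and optimal: "is_arg_min F (\<lambda>w. w \<in> UNIV) wopt"
  shows "(1 / real \<tau>) * (\<Sum>t = 1..\<tau>. (norm (gradient F (W (t - 1))))\<^sup>2)
           \<le> 2 * (F w0 - F wopt) / (\<sigma> * real \<tau>)
             + 4 * \<kappa> / real \<tau> * (\<Sum>t = 1..\<tau>. (1 - (\<Sum>k\<in>S t. \<alpha> k))\<^sup>2)"
proof -
  define C where "C = sqrt \<kappa>"
  define A where "A t = (\<Sum>k\<in>S t. \<alpha> k)" for t
  have bound: "norm (gradient (\<lambda>v. f v x) w) \<le> C" if "x \<in> space M" for w x
    unfolding C_def using gradients_bounded[OF that] by (rule real_le_rsqrt)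
  have round: "\<sigma> / 2 * (norm (gradient F (W t)))\<^sup>2
      \<le> F (W t) - F (W (Suc t)) + \<sigma> / 2 * (4 * \<kappa> * (1 - A (Suc t))\<^sup>2)" if "t < \<tau>" for t
  proof -
    define g where "g k = local_gradient f (n k) (\<xi> k) (W t)" for k
    define p where "p = (\<Sum>k\<in>S (Suc t). \<alpha> k *\<^sub>R g k) /\<^sub>R A (Suc t)"
    have S: "S (Suc t) \<noteq> {}" "S (Suc t) \<subseteq> {1..K}"
      using scheduling[of "Suc t"] that by auto
    have "GDERIV (\<lambda>v. LINT x|D k. f v x) (W t) :> g k" if k: "k \<in> {1..K}" for k
    proof -
      have sp: "space (D k) = space M"
        using distributions[OF k] by (intro sets_eq_imp_space_eq) simp
      have "finite_measure (D k)"
        using distributions[OF k] prob_space.axioms(1) by blast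
      then have "GDERIV (\<lambda>v. LINT x|D k. f v x) (W t)
          :> (LINT x|D k. gradient (\<lambda>v. f v x) (W t))"
        using sp bound loss_differentiable loss_integrable[OF k]
        by (intro GDERIV_integral[where C = C]) auto
      \<comment> \<open>Round \<open>Suc t\<close> starts from model \<open>t\<close>, so
        representativeness is instantiated at \<open>Suc t\<close>.\<close>
      moreover have "(LINT x|D k. gradient (\<lambda>v. f v x) (W t)) = g k"
        using datasets_representative[OF k, of "Suc t"] \<open>t < \<tau>\<close>
        by (simp add: representative_def g_def)
      ultimately show ?thesis
        by simp
    qed
    then have "GDERIV F (W t) :> (\<Sum>k\<in>{1..K}. \<alpha> k *\<^sub>R g k)"
      unfolding F_def global_loss_def[abs_def] by (rule GDERIV_sum_mult)
    then have grad: "gradient F (W t) = (\<Sum>k\<in>{1..K}. \<alpha> k *\<^sub>R g k)"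
      by (rule gradient_eqI)
    have "norm (g k) \<le> C" if k: "k \<in> {1..K}" for k
      unfolding g_def using datasets_nonempty[OF k] samples[OF k] bound
      by (intro norm_local_gradient_le) auto
    then have "norm (gradient F (W t) - p) \<le> 2 * (1 - A (Suc t)) * C"
      unfolding grad p_def A_def using S weights_pos weights_sum
      by (intro norm_sum_diff_partial_mean_le) auto
    \<comment> \<open>Squaring turns the factor 2 into the 4 of the final bound, and
      \<open>C\<close> into \<kappa>.\<close>
    then have "(norm (gradient F (W t) - p))\<^sup>2 \<le> (2 * (1 - A (Suc t)) * C)\<^sup>2"
      by (intro power_mono) auto
    also have "\<dots> = 4 * \<kappa> * (1 - A (Suc t))\<^sup>2"
      unfolding power_mult_distrib using \<kappa>_nonneg by (simp add: C_def)
    finally have err: "(norm (gradient F (W t) - p))\<^sup>2 \<le> 4 * \<kappa> * (1 - A (Suc t))\<^sup>2" .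
    have "A (Suc t) > 0"
      unfolding A_def using S weights_pos finite_subset[OF S(2)] by (intro sum_pos) auto
    then have step: "W (Suc t) = W t - \<sigma> *\<^sub>R p"
      using fl_model_Suc[of \<alpha> S t f n \<xi> \<eta> w0] learning_rate[of "Suc t"] that
      by (simp add: W_def A_def p_def g_def)
    have "\<sigma> / 2 * (norm (gradient F (W t)))\<^sup>2
        \<le> F (W t) - F (W (Suc t)) + \<sigma> / 2 * (norm (gradient F (W t) - p))\<^sup>2"
      unfolding step
      using learning_rate_pos learning_rate_le L_pos
      by (intro inexact_gradient_step[OF F_smooth]) (auto simp: field_simps)
    also have "\<dots> \<le> F (W t) - F (W (Suc t)) + \<sigma> / 2 * (4 * \<kappa> * (1 - A (Suc t))\<^sup>2)"
      using err learning_rate_pos by simp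
    finally show ?thesis .
  qed
  let ?G = "\<Sum>t = 1..\<tau>. (norm (gradient F (W (t - 1))))\<^sup>2" and ?E = "\<Sum>t = 1..\<tau>. (1 - A t)\<^sup>2"
  have shift: "(\<Sum>t = 1..\<tau>. h t) = (\<Sum>t<\<tau>. h (Suc t))" for h :: "nat \<Rightarrow> real"
    by (simp add: sum.atLeast1_atMost_eq)
  have "\<sigma> / 2 * ?G = (\<Sum>t<\<tau>. \<sigma> / 2 * (norm (gradient F (W t)))\<^sup>2)"
    unfolding shift sum_distrib_left by simp
  also have "\<dots> \<le> (\<Sum>t<\<tau>. F (W t) - F (W (Suc t)) + \<sigma> / 2 * (4 * \<kappa> * (1 - A (Suc t))\<^sup>2))"
    using round by (intro sum_mono) auto
  also have "\<dots> = F w0 - F (W \<tau>) + \<sigma> / 2 * (4 * \<kappa> * ?E)"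
    using sum_lessThan_telescope'[of "\<lambda>t. F (W t)" \<tau>]
    unfolding shift sum_distrib_left sum.distrib by (simp add: W_def del: fl_model.simps(2))
  \<comment> \<open>The last iterate left over by telescoping is replaced by the minimum.\<close>
  also have "\<dots> \<le> F w0 - F wopt + \<sigma> / 2 * (4 * \<kappa> * ?E)"
    using optimal by (simp add: is_arg_min_linorder)
  finally have total: "\<sigma> / 2 * ?G \<le> F w0 - F wopt + \<sigma> / 2 * (4 * \<kappa> * ?E)" .
  have "1 / real \<tau> * ?G = 2 / (\<sigma> * real \<tau>) * (\<sigma> / 2 * ?G)"
    using learning_rate_pos by simp
  also have "\<dots> \<le> 2 / (\<sigma> * real \<tau>) * (F w0 - F wopt + \<sigma> / 2 * (4 * \<kappa> * ?E))"
    using total learning_rate_pos by (intro mult_left_mono) auto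
  also have "\<dots> = 2 * (F w0 - F wopt) / (\<sigma> * real \<tau>) + 4 * \<kappa> / real \<tau> * ?E"
    using learning_rate_pos rounds by (simp add: field_simps)
  finally show ?thesis
    by (simp add: A_def)
qed

end
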